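(* Let the cost functions $f_k$, $k\ge1$, be of the type $\mathsf{P_2}$ described in the context (convex, on a compact domain $\mathcal{X}$ of diameter $R<\infty$), let $\{\mathbf{x}_k^\star\}_{k\ge1}$ with $\mathbf{x}_k^\star\in\mathcal{X}_k^\star$ be a sequence whose path length $W_K$ is sublinear in $K$, and let $\{\mathbf{x}_k\}_{k\ge1}$ be generated by $\mathbf{x}_{k+1}=\mathcal{P}_{\mathcal{X}}[\mathbf{x}_k-\alpha(\nabla f_k(\mathbf{x}_k)+\mathbf{e}_k)]$ with step size $0<\alpha<1/(2L)$. Assume that conditions (A1) with $\nu=0$, (A3) and (A4) stated in the context hold. Then $$\mathbb{E}[\mathbf{Reg}_K]\le\mathcal{O}\left(1+\sqrt{K E_K}+W_K\right),$$ i.e. there is a constant $C$ independent of $K$ such that $\mathbb{E}[\mathbf{Reg}_K]\le C(1+\sqrt{KE_K}+W_K)$ for all $K\ge1$.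
   Context: $\|\cdot\|$ is the Euclidean norm. Class $\mathsf{P_2}$: $\mathcal{X}\subset\mathbb{R}^n$ is a nonempty compact convex set with diameter $R<\infty$; for each $k\ge1$, $f_k:\mathbb{R}^n\to\mathbb{R}$ is a (deterministic) smooth convex function, and $\mathcal{X}_k^\star=\arg\min_{\mathbf{x}\in\mathcal{X}}f_k(\mathbf{x})$ is its set of minimizers over $\mathcal{X}$. $\mathcal{P}_{\mathcal{X}}(\mathbf{u})=\arg\min_{\mathbf{y}\in\mathcal{X}}\|\mathbf{y}-\mathbf{u}\|$. Iteration (IOGD, inexact online gradient descent): $\mathbf{x}_1\in\mathcal{X}$ is a deterministic initial point, $\alpha>0$ is a constant step size, and $\mathbf{x}_{k+1}=\mathcal{P}_{\mathcal{X}}[\mathbf{x}_k-\alpha(\nabla f_k(\mathbf{x}_k)+\mathbf{e}_k)]$, where the $\mathbf{e}_k$ are $\mathbb{R}^n$-valued random gradient errors. $\mathcal{F}_k$ is the sigma-field generated by $\mathbf{e}_1,\dots,\mathbf{e}_{k-1}$. Assumptions. (A1) with $\nu=0$: for all $k\ge1$, $\mathbb{E}[\|\mathbf{e}_k\|^2\mid\mathcal{F}_k]\le\varepsilon_k^2$, with $0\le\varepsilon_k\le\varepsilon<\infty$. (A3) $\|\nabla f_k(\mathbf{u})-\nabla f_k(\mathbf{v})\|\le L\|\mathbf{u}-\mathbf{v}\|$ for all $k\ge1$, $\mathbf{u},\mathbf{v}\in\mathcal{X}$. (A4) All minimizers $\mathbf{x}_k^\star\in\mathcal{X}_k^\star$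 lie in the relative interior of $\mathcal{X}$ and satisfy $\nabla f_k(\mathbf{x}_k^\star)=0$. Regret, path length, cumulative error: $\mathbf{Reg}_K=\sum_{k=1}^K(f_k(\mathbf{x}_k)-f_k(\mathbf{x}_k^\star))$, $W_K=\sum_{k=2}^K\|\mathbf{x}_k^\star-\mathbf{x}_{k-1}^\star\|$, $E_K=\sum_{k=1}^K\varepsilon_k$. Sublinear means $W_K/K\to0$. *)

theory Defs
  imports "HOL-Probability.Probability"
begin

(* Meaningful at points of differentiability only, see gderiv_gradient below. *)
definition gradient :: "('a::real_inner \<Rightarrow> real) \<Rightarrow> 'a \<Rightarrow> 'a" where
  "gradient h z = (THE D. GDERIV h z :> D)"

lemma gradient_eq:
  assumes "GDERIV h z :> D"
  shows "gradient h z = D"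
  unfolding gradient_def
proof (rule the_equality)
  show "GDERIV h z :> D" by (rule assms)
next
  fix D' assume "GDERIV h z :> D'"
  then have "(\<lambda>v. v \<bullet> D') = (\<lambda>v. v \<bullet> D)"
    using assms unfolding gderiv_def by (rule has_derivative_unique)
  then have "v \<bullet> (D' - D) = 0" for v
    by (simp add: inner_diff_right fun_eq_iff)
  from this[of "D' - D"] show "D' = D" by simp
qed

lemma gderiv_gradient:
  fixes h :: "'a::euclidean_space \<Rightarrow> real"
  assumes "h differentiable (at z)"
  shows "GDERIV h z :> gradient h z"
proof -
  obtain h' where h': "(h has_derivative h') (at z)"
    using assms by (auto simp: differentiable_def)
  then have "linear h'"
    by (rule has_derivative_linear)
  then have "h' = (\<lambda>v. v \<bullet> adjoint h' 1)"
    by (auto simp: fun_eq_iff adjoint_works)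
  then have "GDERIV h z :> adjoint h' 1"
    using h' by (simp add: gderiv_def)
  then show ?thesis
    by (simp add: gradient_eq)
qed

definition minimizers :: "('a \<Rightarrow> real) \<Rightarrow> 'a set \<Rightarrow> 'a set" where
  "minimizers h X = {z. is_arg_min h (\<lambda>y. y \<in> X) z}"

(* Time indices start at 1 throughout. Smoothness of a cost is differentiability on the
   whole space, the least regularity under which its gradient is defined. *)
definition class_P2 ::
  "'a::euclidean_space set \<Rightarrow> real \<Rightarrow> (nat \<Rightarrow> 'a \<Rightarrow> real) \<Rightarrow> bool" where
  "class_P2 X R f \<longleftrightarrow>
     X \<noteq> {} \<and> compact X \<and> convex X \<and> diameter X = R \<and>
     (\<forall>k\<ge>1. convex_on UNIV (f k) \<and> (\<forall>z. f k differentiable (at z)))"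

(* The sigma-field generated by e 1, ..., e (k - 1); it is trivial for k = 1. *)
definition error_field ::
  "'w measure \<Rightarrow> (nat \<Rightarrow> 'w \<Rightarrow> 'a::topological_space) \<Rightarrow> nat \<Rightarrow> 'w measure" where
  "error_field M e k =
     sigma (space M) (\<Union>i\<in>{1..<k}. {e i -` A \<inter> space M | A. A \<in> sets borel})"

lemma subalgebra_error_field:
  assumes "\<And>k. k \<ge> 1 \<Longrightarrow> e k \<in> borel_measurable M"
  shows "subalgebra M (error_field M e k)"
proof -
  have "(\<Union>i\<in>{1..<k}. {e i -` A \<inter> space M | A. A \<in> sets borel}) \<subseteq> sets M"
    using assms by (auto intro: measurable_sets)
  then show ?thesis
    unfolding subalgebra_def error_field_def
    by (auto simp: space_measure_of_conv sets_measure_of_conv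
        dest: sets.sigma_sets_subset)
qed

(* The conditional second moment is taken in [0, \<infinity>] by nn_cond_exp, so that the
   bound entails square integrability of the errors; real_cond_exp could be 0 where the
   conditional expectation is infinite. *)
definition conditional_error_bound ::
  "'w measure \<Rightarrow> (nat \<Rightarrow> 'w \<Rightarrow> 'a::real_normed_vector) \<Rightarrow> (nat \<Rightarrow> real) \<Rightarrow> bool" where
  "conditional_error_bound M e \<epsilon> \<longleftrightarrow>
     (\<forall>k\<ge>1. AE \<omega> in M.
        nn_cond_exp M (error_field M e k) (\<lambda>\<omega>. ennreal ((norm (e k \<omega>))\<^sup>2)) \<omega>
          \<le> ennreal ((\<epsilon> k)\<^sup>2))"

definition regret ::
  "(nat \<Rightarrow> 'a \<Rightarrow> real) \<Rightarrow> (nat \<Rightarrow> 'a) \<Rightarrow> (nat \<Rightarrow> 'a) \<Rightarrow> nat \<Rightarrow> real" where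
  "regret f x xstar K = (\<Sum>k=1..K. f k (x k) - f k (xstar k))"

definition path_length :: "(nat \<Rightarrow> 'a::real_normed_vector) \<Rightarrow> nat \<Rightarrow> real" where
  "path_length xstar K = (\<Sum>k=2..K. norm (xstar k - xstar (k - 1)))"

definition cumulative_error :: "(nat \<Rightarrow> real) \<Rightarrow> nat \<Rightarrow> real" where
  "cumulative_error \<epsilon> K = (\<Sum>k=1..K. \<epsilon> k)"

end

theory Submission
  imports Defs
begin

text \<open>
  Write \<open>D = \<nabla>f\<^sub>k(x\<^sub>k) \<bullet> (x\<^sub>k - x\<^sub>k\<^sup>*)\<close>, which dominates the regret of round \<open>k\<close> by convexity.
  The variational inequality of the projection, tested against \<open>x\<^sub>k\<^sup>*\<close>, bounds \<open>2\<alpha>D\<close> by the decrease of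
  the squared distance to \<open>x\<^sub>k\<^sup>*\<close>, minus the squared length of the step, plus two cross terms: one of the
  error, at most \<open>2\<alpha>R \<parallel>e\<^sub>k\<parallel>\<close>, and one of the gradient with the step \<open>x\<^sub>k\<^sub>+\<^sub>1 - x\<^sub>k\<close>.

  The gradient term is the only delicate one. It has to be paid for by half of \<open>D\<close> and by the
  squared step, which is a form of cocoercivity of \<open>\<nabla>f\<^sub>k\<close>. The usual proof of cocoercivity compares
  function values at points reached by a gradient step of length \<open>1/L\<close>, and such points can leave \<open>X\<close>,
  where nothing is known about the Lipschitz constant. The remedy is to cut the segment from \<open>x\<^sub>k\<^sup>*\<close> to
  \<open>x\<^sub>k\<close> into \<open>N\<close> pieces: on each piece the comparison points need only be displaced by \<open>O(1/N)\<close>, so they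
  stay in \<open>X\<close> because \<open>x\<^sub>k\<^sup>*\<close> is a relative interior point, and the piecewise inequalities add up
  without loss. This is \<open>gradient_increment_cauchy_schwarz\<close>; its constant is
  independent of the size of the margin around \<open>x\<^sub>k\<^sup>*\<close>, which may tend to \<open>0\<close> as \<open>k\<close> grows.

  The resulting bound on each round (\<open>inexact_gradient_step_regret\<close>) is summed over the rounds.
  The squared distances telescope up to the motion of the minimizers, which costs at most
  \<open>2R W\<^sub>K\<close> (\<open>drifting_distance_telescope\<close>). Taking expectations gives
  \<open>(R\<^sup>2 + 2R W\<^sub>K)/\<alpha> + 2R E\<^sub>K\<close>, since the conditional second moment bound implies \<open>E \<parallel>e\<^sub>k\<parallel> \<le> \<epsilon>\<^sub>k\<close>.
  Finally \<open>E\<^sub>K \<le> \<epsilon>\<^sub>m\<^sub>a\<^sub>x K\<close> turns \<open>E\<^sub>K\<close> into a multiple of \<open>\<surd>(K E\<^sub>K)\<close>.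
\<close>

section \<open>Smooth convex functions on a convex set\<close>

lemma GDERIV_on_line:
  fixes h :: "'a::euclidean_space \<Rightarrow> real"
  assumes "GDERIV h (a + t *\<^sub>R d) :> D"
  shows "((\<lambda>t. h (a + t *\<^sub>R d)) has_real_derivative (D \<bullet> d)) (at t)"
proof -
  have "(h has_derivative (\<lambda>v. v \<bullet> D)) (at (a + t *\<^sub>R d))"
    using assms by (simp add: gderiv_def)
  moreover have "((\<lambda>t. a + t *\<^sub>R d) has_derivative (\<lambda>s. s *\<^sub>R d)) (at t)"
    by (auto intro!: derivative_eq_intros)
  ultimately have "((\<lambda>t. h (a + t *\<^sub>R d)) has_derivative (\<lambda>s. (s *\<^sub>R d) \<bullet> D)) (at t)"
    by (rule has_derivative_compose[rotated])
  moreover have "(\<lambda>s. (s *\<^sub>R d) \<bullet> D) = (*) (D \<bullet> d)"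
    by (auto simp: fun_eq_iff inner_commute)
  ultimately show ?thesis
    by (simp add: has_field_derivative_def)
qed

lemma convex_above_tangent_plane:
  fixes h :: "'a::euclidean_space \<Rightarrow> real"
  assumes "convex_on UNIV h" and D: "GDERIV h a :> D"
  shows "h a + D \<bullet> (b - a) \<le> h b"
proof -
  define \<phi> where "\<phi> = (\<lambda>t. h (a + t *\<^sub>R (b - a)))"
  have "(\<phi> has_real_derivative (D \<bullet> (b - a))) (at 0)"
    unfolding \<phi>_def using D by (intro GDERIV_on_line) simp
  then have "((\<lambda>t. (\<phi> t - \<phi> 0) / t) \<longlongrightarrow> D \<bullet> (b - a)) (at 0)"
    by (simp add: has_field_derivative_iff)
  then have lim: "((\<lambda>t. (\<phi> t - \<phi> 0) / t) \<longlongrightarrow> D \<bullet> (b - a)) (at_right 0)"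
    by (rule tendsto_mono[rotated]) (simp add: at_le)
  have "(\<phi> t - \<phi> 0) / t \<le> h b - h a" if "0 < t" "t < 1" for t
  proof -
    have "h ((1 - t) *\<^sub>R a + t *\<^sub>R b) \<le> (1 - t) * h a + t * h b"
      using assms(1) that by (intro convex_onD) auto
    moreover have "(1 - t) *\<^sub>R a + t *\<^sub>R b = a + t *\<^sub>R (b - a)"
      by (simp add: algebra_simps)
    ultimately show ?thesis
      using that by (simp add: \<phi>_def field_simps)
  qed
  then have "\<forall>\<^sub>F t in at_right 0. (\<phi> t - \<phi> 0) / t \<le> h b - h a"
    unfolding eventually_at_right_field by (intro exI[of _ 1]) auto
  with lim have "D \<bullet> (b - a) \<le> h b - h a"
    by (rule tendsto_upperbound) simp
  then show ?thesis by simp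
qed

lemma lipschitz_gradient_continuous:
  fixes g :: "'a::real_normed_vector \<Rightarrow> 'a"
  assumes lip: "\<And>u v. u \<in> X \<Longrightarrow> v \<in> X \<Longrightarrow> norm (g u - g v) \<le> L * norm (u - v)"
  shows "continuous_on X g"
proof (rule lipschitz_on_continuous_on)
  show "\<bar>L\<bar>-lipschitz_on X g"
    unfolding lipschitz_on_def dist_norm
    by (auto intro!: order_trans[OF lip] mult_right_mono)
qed

lemma lipschitz_gradient_descent:
  fixes h :: "'a::euclidean_space \<Rightarrow> real" and g :: "'a \<Rightarrow> 'a"
  assumes g: "\<And>z. GDERIV h z :> g z"
    and lip: "\<And>u v. u \<in> X \<Longrightarrow> v \<in> X \<Longrightarrow> norm (g u - g v) \<le> L * norm (u - v)"
    and X: "convex X" "a \<in> X" "b \<in> X"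
  shows "h b \<le> h a + g a \<bullet> (b - a) + L / 2 * (norm (b - a))\<^sup>2"
proof -
  define d where "d = b - a"
  define \<psi> where "\<psi> = (\<lambda>t. h (a + t *\<^sub>R d) - t * (g a \<bullet> d) - L / 2 * t\<^sup>2 * (norm d)\<^sup>2)"
  have "\<psi> 1 \<le> \<psi> 0"
  proof (rule DERIV_nonpos_imp_nonincreasing[of 0 1 \<psi>])
    fix t :: real assume t: "0 \<le> t" "t \<le> 1"
    have in_X: "a + t *\<^sub>R d \<in> X"
      using convexD_alt[OF X t] by (simp add: d_def algebra_simps)
    have "(g (a + t *\<^sub>R d) - g a) \<bullet> d \<le> norm (g (a + t *\<^sub>R d) - g a) * norm d"
      by (rule norm_cauchy_schwarz)
    also have "\<dots> \<le> (L * norm (t *\<^sub>R d)) * norm d"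
      using lip[OF in_X X(2)] by (intro mult_right_mono) auto
    also have "\<dots> = L * t * (norm d)\<^sup>2"
      using t by (simp add: power2_eq_square)
    finally have "g (a + t *\<^sub>R d) \<bullet> d - g a \<bullet> d - L * t * (norm d)\<^sup>2 \<le> 0"
      by (simp add: inner_diff_left)
    moreover have "(\<psi> has_real_derivative
        (g (a + t *\<^sub>R d) \<bullet> d - g a \<bullet> d - L * t * (norm d)\<^sup>2)) (at t)"
      unfolding \<psi>_def
      by (rule derivative_eq_intros GDERIV_on_line g refl)+ simp
    ultimately show "\<exists>y. DERIV \<psi> t :> y \<and> y \<le> 0" by blast
  qed simp
  then show ?thesis by (simp add: \<psi>_def d_def)
qed

text \<open>
  For a quadratic with Hessian \<open>H \<le> L I\<close> and \<open>a - b = t v\<close> this is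
  \<open>2 u\<^sup>T H v \<le> v\<^sup>T H v + L \<parallel>u\<parallel>\<^sup>2\<close> scaled by \<open>t\<^sup>2\<close>. In general each of the points \<open>a - t u\<close> and
  \<open>b + t u\<close> is squeezed between the tangent plane at one of \<open>a, b\<close> and the quadratic upper bound at the
  other; in the sum of the two estimates the function values cancel.
\<close>

lemma gradient_increment_short_step:
  fixes h :: "'a::euclidean_space \<Rightarrow> real" and g :: "'a \<Rightarrow> 'a"
  assumes convex: "convex_on UNIV h" and g: "\<And>z. GDERIV h z :> g z"
    and lip: "\<And>u v. u \<in> X \<Longrightarrow> v \<in> X \<Longrightarrow> norm (g u - g v) \<le> L * norm (u - v)"
    and X: "convex X" "a \<in> X" "b \<in> X" "a - t *\<^sub>R u \<in> X" "b + t *\<^sub>R u \<in> X"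
  shows "2 * t * ((g a - g b) \<bullet> u) - L * t\<^sup>2 * (norm u)\<^sup>2 \<le> (g a - g b) \<bullet> (a - b)"
proof -
  have "h b + g b \<bullet> (a - t *\<^sub>R u - b) \<le> h (a - t *\<^sub>R u)"
    by (rule convex_above_tangent_plane[OF convex g])
  also have "\<dots> \<le> h a + g a \<bullet> (a - t *\<^sub>R u - a) + L / 2 * (norm (a - t *\<^sub>R u - a))\<^sup>2"
    by (rule lipschitz_gradient_descent[OF g lip X(1,2,4)])
  finally have 1: "h b + g b \<bullet> (a - b) - t * (g b \<bullet> u)
      \<le> h a - t * (g a \<bullet> u) + L / 2 * t\<^sup>2 * (norm u)\<^sup>2"
    by (simp add: inner_diff_right power_mult_distrib)
  have "h a + g a \<bullet> (b + t *\<^sub>R u - a) \<le> h (b + t *\<^sub>R u)"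
    by (rule convex_above_tangent_plane[OF convex g])
  also have "\<dots> \<le> h b + g b \<bullet> (b + t *\<^sub>R u - b) + L / 2 * (norm (b + t *\<^sub>R u - b))\<^sup>2"
    by (rule lipschitz_gradient_descent[OF g lip X(1,3,5)])
  finally have 2: "h a - g a \<bullet> (a - b) + t * (g a \<bullet> u)
      \<le> h b + t * (g b \<bullet> u) + L / 2 * t\<^sup>2 * (norm u)\<^sup>2"
    by (simp add: inner_diff_right inner_add_right power_mult_distrib)
  have "L / 2 * t\<^sup>2 * (norm u)\<^sup>2 + L / 2 * t\<^sup>2 * (norm u)\<^sup>2 = L * t\<^sup>2 * (norm u)\<^sup>2" by simp
  with 1 2 show ?thesis
    by (simp add: inner_diff_left algebra_simps)
qed

text \<open>
  The subdivision argument. If the segment is cut into \<open>N\<close> equal pieces and the short step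
  estimate is applied on each with \<open>t = 1/N\<close>, both sides scale alike: the increments of the gradient
  telescope, and the \<open>N\<close> error terms \<open>L \<parallel>u\<parallel>\<^sup>2 / N\<^sup>2\<close>, multiplied by \<open>N\<close>, sum to \<open>L \<parallel>u\<parallel>\<^sup>2\<close> whatever \<open>N\<close>
  is. So \<open>N\<close> may be chosen large enough for all displaced points to lie in \<open>X\<close>. The endpoint
  \<open>y + v\<close> may be on the boundary, hence the restriction to \<open>s < 1\<close>: at distance \<open>s\<close> along the
  segment a fraction \<open>1 - s\<close> of the room \<open>\<delta>\<close> around \<open>y\<close> is left.
\<close>

lemma gradient_increment_two_sided_room:
  fixes h :: "'a::euclidean_space \<Rightarrow> real" and g :: "'a \<Rightarrow> 'a"
  assumes convex: "convex_on UNIV h" and g: "\<And>z. GDERIV h z :> g z"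
    and lip: "\<And>u v. u \<in> X \<Longrightarrow> v \<in> X \<Longrightarrow> norm (g u - g v) \<le> L * norm (u - v)"
    and X: "convex X" "y \<in> X" "y + v \<in> X" and \<delta>: "0 < \<delta>" "y + \<delta> *\<^sub>R u \<in> X" "y - \<delta> *\<^sub>R u \<in> X"
    and s: "0 \<le> s" "s < 1"
  shows "2 * ((g (y + s *\<^sub>R v) - g y) \<bullet> u) - L * (norm u)\<^sup>2 \<le> (g (y + s *\<^sub>R v) - g y) \<bullet> (s *\<^sub>R v)"
proof -
  obtain n where n: "inverse (real (Suc n)) < (1 - s) * \<delta>"
    using reals_Archimedean[of "(1 - s) * \<delta>"] \<delta>(1) s by auto
  \<comment> \<open>The displacement \<open>1/N\<close> must fit into the room left at the far end of the segment.\<close>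
  define N where "N = Suc n"
  have N: "0 < real N" "1 / real N \<le> (1 - s) * \<delta>"
    using n by (auto simp: N_def inverse_eq_divide)
  define p where "p i = y + (real i * s / real N) *\<^sub>R v" for i
  have room: "p i + c *\<^sub>R u \<in> X" if "i \<le> N" "\<bar>c\<bar> \<le> 1 / real N" for i c
  proof -
    define \<theta> where "\<theta> = real i * s / real N"
    have "real i * s \<le> real N * s"
      using that s by (intro mult_right_mono) auto
    then have \<theta>: "0 \<le> \<theta>" "\<theta> \<le> s"
      using s N by (auto simp: \<theta>_def field_simps)
    \<comment> \<open>The displaced point is a convex combination of \<open>y + \<gamma> u\<close>, itself between \<open>y - \<delta> u\<close> and
      \<open>y + \<delta> u\<close>, and of \<open>y + v\<close>.\<close>
    define \<gamma> where "\<gamma> = c / (1 - \<theta>)"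
    have "(1 - s) * \<delta> \<le> (1 - \<theta>) * \<delta>"
      using \<theta> \<delta> by (intro mult_right_mono) auto
    with that N have "\<bar>c\<bar> \<le> (1 - \<theta>) * \<delta>" by linarith
    then have \<gamma>: "\<bar>\<gamma>\<bar> \<le> \<delta>"
      using \<theta> s by (simp add: \<gamma>_def field_simps abs_mult)
    define \<mu> where "\<mu> = (\<gamma> + \<delta>) / (2 * \<delta>)"
    have \<mu>: "0 \<le> \<mu>" "\<mu> \<le> 1" "2 * \<mu> * \<delta> = \<gamma> + \<delta>"
      using \<gamma> \<delta> by (auto simp: \<mu>_def field_simps)
    have "(1 - \<mu>) *\<^sub>R (y - \<delta> *\<^sub>R u) + \<mu> *\<^sub>R (y + \<delta> *\<^sub>R u) \<in> X"
      using X \<delta> \<mu> by (intro convexD_alt) auto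
    moreover have "(1 - \<mu>) *\<^sub>R (y - \<delta> *\<^sub>R u) + \<mu> *\<^sub>R (y + \<delta> *\<^sub>R u) = y + (2 * \<mu> * \<delta> - \<delta>) *\<^sub>R u"
      by (simp add: algebra_simps) (simp flip: scaleR_add_left)
    ultimately have "y + \<gamma> *\<^sub>R u \<in> X" using \<mu> by simp
    then have "(1 - \<theta>) *\<^sub>R (y + \<gamma> *\<^sub>R u) + \<theta> *\<^sub>R (y + v) \<in> X"
      using X \<theta> s by (intro convexD_alt) auto
    moreover have "(1 - \<theta>) *\<^sub>R (y + \<gamma> *\<^sub>R u) + \<theta> *\<^sub>R (y + v) = y + \<theta> *\<^sub>R v + ((1 - \<theta>) * \<gamma>) *\<^sub>R u"
      by (simp add: algebra_simps)
    moreover have "(1 - \<theta>) * \<gamma> = c" using \<theta> s by (simp add: \<gamma>_def)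
    ultimately show ?thesis by (simp add: p_def \<theta>_def)
  qed
  have step: "2 * ((g (p (Suc i)) - g (p i)) \<bullet> u) - L / real N * (norm u)\<^sup>2
      \<le> (g (p (Suc i)) - g (p i)) \<bullet> (s *\<^sub>R v)" if "i < N" for i
  proof -
    define \<Delta> where "\<Delta> = g (p (Suc i)) - g (p i)"
    have diff: "p (Suc i) - p i = (1 / real N) *\<^sub>R (s *\<^sub>R v)"
      by (simp add: p_def add_divide_distrib algebra_simps)
    have "2 * (1 / real N) * (\<Delta> \<bullet> u) - L * (1 / real N)\<^sup>2 * (norm u)\<^sup>2
        \<le> \<Delta> \<bullet> (p (Suc i) - p i)"
      unfolding \<Delta>_def
      using room[of "Suc i" 0] room[of i 0] room[of "Suc i" "- (1 / real N)"] room[of i "1 / real N"] that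
      by (intro gradient_increment_short_step[OF convex g lip X(1)]) auto
    also have "\<dots> = (1 / real N) * (\<Delta> \<bullet> (s *\<^sub>R v))" by (simp add: diff)
    finally have "real N * (2 * (1 / real N) * (\<Delta> \<bullet> u) - L * (1 / real N)\<^sup>2 * (norm u)\<^sup>2)
        \<le> real N * ((1 / real N) * (\<Delta> \<bullet> (s *\<^sub>R v)))"
      using N by (intro mult_left_mono) auto
    then show ?thesis
      using N unfolding \<Delta>_def[symmetric] by (simp add: power2_eq_square algebra_simps)
  qed
  have tele: "(\<Sum>i<N. g (p (Suc i)) - g (p i)) = g (y + s *\<^sub>R v) - g y"
    using N sum_lessThan_telescope[of "\<lambda>i. g (p i)" N] by (simp add: p_def)
  have total: "(\<Sum>i<N. 2 * ((g (p (Suc i)) - g (p i)) \<bullet> u) - L / real N * (norm u)\<^sup>2)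
      = 2 * ((\<Sum>i<N. g (p (Suc i)) - g (p i)) \<bullet> u) - real N * (L / real N * (norm u)\<^sup>2)"
    unfolding sum_subtractf[of "\<lambda>i. 2 * ((g (p (Suc i)) - g (p i)) \<bullet> u)"] inner_sum_left sum_distrib_left
    by simp
  have "2 * ((\<Sum>i<N. g (p (Suc i)) - g (p i)) \<bullet> u) - L * (norm u)\<^sup>2
      = (\<Sum>i<N. 2 * ((g (p (Suc i)) - g (p i)) \<bullet> u) - L / real N * (norm u)\<^sup>2)"
    unfolding total using N by simp
  also have "\<dots> \<le> (\<Sum>i<N. (g (p (Suc i)) - g (p i)) \<bullet> (s *\<^sub>R v))"
    by (intro sum_mono step) auto
  also have "\<dots> = (\<Sum>i<N. g (p (Suc i)) - g (p i)) \<bullet> (s *\<^sub>R v)"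
    by (rule inner_sum_left[symmetric])
  finally show ?thesis unfolding tele .
qed

text \<open>
  A linearised Cauchy-Schwarz inequality for the averaged Hessian \<open>H\<close> between \<open>y\<close> and \<open>a\<close>: with
  \<open>v = a - y\<close> and \<open>u = a - w\<close> it reads \<open>2 u\<^sup>T H v - L \<parallel>u\<parallel>\<^sup>2 \<le> v\<^sup>T H v\<close>. Only directions \<open>u\<close> parallel to
  the affine hull of \<open>X\<close> occur, so \<open>X\<close> may be lower dimensional and \<open>g\<close> may have components normal to it.
\<close>

lemma gradient_increment_cauchy_schwarz:
  fixes h :: "'a::euclidean_space \<Rightarrow> real" and g :: "'a \<Rightarrow> 'a"
  assumes convex: "convex_on UNIV h" and g: "\<And>z. GDERIV h z :> g z"
    and lip: "\<And>u v. u \<in> X \<Longrightarrow> v \<in> X \<Longrightarrow> norm (g u - g v) \<le> L * norm (u - v)"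
    and X: "convex X" "y \<in> rel_interior X" "a \<in> X" "w \<in> X"
  shows "2 * ((g a - g y) \<bullet> (a - w)) - L * (norm (a - w))\<^sup>2 \<le> (g a - g y) \<bullet> (a - y)"
proof -
  define u where "u = a - w"
  define v where "v = a - y"
  obtain r where y: "y \<in> X" and r: "0 < r" "ball y r \<inter> affine hull X \<subseteq> X"
    using X(2) by (auto simp: mem_rel_interior_ball)
  define \<delta> where "\<delta> = r / 2 / (norm u + 1)"
  have "0 < norm u + 1" by (simp add: add_nonneg_pos)
  then have \<delta>: "0 < \<delta>" and "\<delta> * (norm u + 1) = r / 2"
    using r(1) unfolding \<delta>_def by (simp, metis less_irrefl nonzero_divide_eq_eq)
  then have small: "\<delta> * norm u < r"
    using r \<open>0 < \<delta>\<close> by (simp add: algebra_simps)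
  have hull: "y + c *\<^sub>R u \<in> affine hull X" for c
    unfolding u_def using y X by (intro mem_affine_3_minus) (auto intro: hull_inc)
  have "y + c *\<^sub>R u \<in> X" if "\<bar>c\<bar> = \<delta>" for c
    using r(2) hull[of c] small that by (auto simp: dist_norm)
  from this[of \<delta>] this[of "- \<delta>"] \<delta>
  have room: "y + \<delta> *\<^sub>R u \<in> X" "y - \<delta> *\<^sub>R u \<in> X" by auto
  \<comment> \<open>The inequality holds before the endpoint and extends to it by continuity of the gradient on \<open>X\<close>.\<close>
  define F where "F s = (g (y + s *\<^sub>R v) - g y) \<bullet> (s *\<^sub>R v - 2 *\<^sub>R u) + L * (norm u)\<^sup>2" for s
  have contg: "continuous_on X g"
    by (rule lipschitz_gradient_continuous[OF lip])
  have seg: "y + s *\<^sub>R v \<in> X" if "s \<in> {0..1}" for s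
    using convexD_alt[OF X(1) y X(3), of s] that by (simp add: v_def algebra_simps)
  have "continuous_on {0..1} (\<lambda>s. g (y + s *\<^sub>R v))"
    by (rule continuous_on_compose2[OF contg]) (auto intro!: continuous_intros seg)
  then have "continuous_on {0..1} F"
    unfolding F_def by (intro continuous_intros)
  moreover have "0 \<le> F s" if "s \<in> {0..<1}" for s
  proof -
    have "2 * ((g (y + s *\<^sub>R v) - g y) \<bullet> u) - L * (norm u)\<^sup>2 \<le> (g (y + s *\<^sub>R v) - g y) \<bullet> (s *\<^sub>R v)"
      using y X that by (intro gradient_increment_two_sided_room[OF convex g lip X(1) y _ \<delta> room]) (auto simp: v_def)
    then show ?thesis
      unfolding F_def by (simp only: inner_diff_right inner_scaleR_right)
  qed
  ultimately have "0 \<le> F 1"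
    using continuous_ge_on_closure[of "{0..<1::real}" F 1 0] by simp
  then show ?thesis
    by (simp add: F_def u_def v_def inner_diff_right algebra_simps)
qed

section \<open>One step of inexact projected gradient descent\<close>

text \<open>
  The projected point minimizes \<open>d \<bullet> p + \<parallel>p - a\<parallel>\<^sup>2 / (2\<alpha>)\<close> over \<open>X\<close>. Compared with mere
  nonexpansiveness of the projection, this retains the term \<open>- \<parallel>p - a\<parallel>\<^sup>2\<close>, which later
  absorbs the gradient, and avoids a squared error \<open>\<parallel>err\<parallel>\<^sup>2\<close>.
\<close>

lemma projection_three_point:
  fixes X :: "'a::euclidean_space set" and a y d :: 'a and \<alpha> :: real
  assumes "convex X" "closed X" "y \<in> X"
  defines "p \<equiv> closest_point X (a - \<alpha> *\<^sub>R d)"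
  shows "2 * \<alpha> * (d \<bullet> (p - y)) \<le> (norm (a - y))\<^sup>2 - (norm (p - y))\<^sup>2 - (norm (p - a))\<^sup>2"
proof -
  have "(a - \<alpha> *\<^sub>R d - p) \<bullet> (y - p) \<le> 0"
    unfolding p_def by (rule closest_point_dot[OF assms(1-3)])
  moreover have "(norm (a - y))\<^sup>2 - (norm (p - y))\<^sup>2 - (norm (p - a))\<^sup>2 = 2 * ((a - p) \<bullet> (p - y))"
    by (simp add: power2_norm_eq_inner inner_diff_left inner_diff_right inner_commute)
  ultimately show ?thesis
    by (simp add: inner_diff_left inner_diff_right inner_commute algebra_simps)
qed

text \<open>
  The regret is charged to the point \<open>a\<close> before the step, whereas the projection inequality controls
  \<open>g a \<bullet> (p - y)\<close> at the point after it. The difference \<open>g a \<bullet> (a - p)\<close> is at most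
  \<open>D/2 + L/2 \<parallel>p - a\<parallel>\<^sup>2\<close> by the Cauchy-Schwarz inequality above, because the gradient vanishes at \<open>y\<close>.
\<close>

lemma inexact_gradient_step_regret:
  fixes h :: "'a::euclidean_space \<Rightarrow> real" and g :: "'a \<Rightarrow> 'a" and a err :: 'a and \<alpha> :: real
  assumes convex: "convex_on UNIV h" and g: "\<And>z. GDERIV h z :> g z"
    and lip: "\<And>u v. u \<in> X \<Longrightarrow> v \<in> X \<Longrightarrow> norm (g u - g v) \<le> L * norm (u - v)"
    and X: "convex X" "compact X" "a \<in> X"
    and y: "y \<in> rel_interior X" "g y = 0"
    and \<alpha>: "0 < \<alpha>" "\<alpha> * L \<le> 1"
  defines "p \<equiv> closest_point X (a - \<alpha> *\<^sub>R (g a + err))"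
  shows "h a - h y \<le> ((norm (a - y))\<^sup>2 - (norm (p - y))\<^sup>2) / \<alpha> + 2 * diameter X * norm err"
proof -
  have yX: "y \<in> X" using y rel_interior_subset by blast
  have closed: "closed X" using X by (simp add: compact_imp_closed)
  have pX: "p \<in> X" unfolding p_def using closed yX by (intro closest_point_in_set) auto
  define D where "D = g a \<bullet> (a - y)"
  have "h a + g a \<bullet> (y - a) \<le> h y"
    by (rule convex_above_tangent_plane[OF convex g])
  then have D: "h a - h y \<le> D" by (simp add: D_def inner_diff_right)
  have cs: "2 * (g a \<bullet> (a - p)) - L * (norm (p - a))\<^sup>2 \<le> D"
    using gradient_increment_cauchy_schwarz[OF convex g lip X(1) y(1) X(3) pX] y(2)
    by (simp add: D_def norm_minus_commute)
  have "2 * \<alpha> * ((g a + err) \<bullet> (p - y)) \<le> (norm (a - y))\<^sup>2 - (norm (p - y))\<^sup>2 - (norm (p - a))\<^sup>2"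
    unfolding p_def by (rule projection_three_point[OF X(1) closed yX])
  moreover have "(g a + err) \<bullet> (p - y) = D - g a \<bullet> (a - p) + err \<bullet> (p - y)"
    by (simp add: D_def inner_add_left inner_diff_right)
  moreover have "- (norm err * diameter X) \<le> err \<bullet> (p - y)"
  proof -
    have "\<bar>err \<bullet> (p - y)\<bar> \<le> norm err * norm (p - y)" by (rule Cauchy_Schwarz_ineq2)
    also have "\<dots> \<le> norm err * diameter X"
      using diameter_bounded_bound[OF compact_imp_bounded[OF X(2)] pX yX]
      by (intro mult_left_mono) (auto simp: dist_norm)
    finally show ?thesis by linarith
  qed
  moreover have "D / 2 - L / 2 * (norm (p - a))\<^sup>2 \<le> D - g a \<bullet> (a - p)"
    using cs by (simp add: field_simps)
  ultimately have "2 * \<alpha> * (D / 2 - L / 2 * (norm (p - a))\<^sup>2 - norm err * diameter X)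
      \<le> (norm (a - y))\<^sup>2 - (norm (p - y))\<^sup>2 - (norm (p - a))\<^sup>2"
    using \<alpha>(1) by (elim order_trans[rotated]) (intro mult_left_mono, auto)
  moreover have "\<alpha> * L * (norm (p - a))\<^sup>2 \<le> 1 * (norm (p - a))\<^sup>2"
    using \<alpha> by (intro mult_right_mono) auto
  ultimately have "\<alpha> * D \<le> (norm (a - y))\<^sup>2 - (norm (p - y))\<^sup>2 + \<alpha> * (2 * diameter X * norm err)"
    by (simp add: algebra_simps)
  then have "D \<le> ((norm (a - y))\<^sup>2 - (norm (p - y))\<^sup>2) / \<alpha> + 2 * diameter X * norm err"
    using \<alpha>(1) by (simp add: field_simps)
  with D show ?thesis by linarith
qed

section \<open>Drifting comparators\<close>

text \<open>
  Replacing the comparator \<open>y\<^sub>K\<close> by \<open>y\<^sub>K\<^sub>+\<^sub>1\<close> changes a squared distance by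
  \<open>a\<^sup>2 - b\<^sup>2 = (a - b)(a + b) \<le> 2R \<parallel>y\<^sub>K\<^sub>+\<^sub>1 - y\<^sub>K\<parallel>\<close>. The induction carries along the last negative square, which
  the next round needs.
\<close>

lemma drifting_distance_telescope:
  fixes z y :: "nat \<Rightarrow> 'a::real_normed_vector"
  assumes R: "\<And>i j. i \<ge> 1 \<Longrightarrow> j \<ge> 1 \<Longrightarrow> norm (z i - y j) \<le> R" and "K \<ge> 1"
  shows "(\<Sum>k=1..K. (norm (z k - y k))\<^sup>2 - (norm (z (k + 1) - y k))\<^sup>2) \<le> R\<^sup>2 + 2 * R * path_length y K"
proof -
  have "(\<Sum>k=1..K. (norm (z k - y k))\<^sup>2 - (norm (z (k + 1) - y k))\<^sup>2)
      \<le> R\<^sup>2 + 2 * R * path_length y K - (norm (z (K + 1) - y K))\<^sup>2"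
    using \<open>K \<ge> 1\<close>
  proof (induction K rule: nat_induct_at_least)
    case base
    have "(norm (z 1 - y 1))\<^sup>2 \<le> R\<^sup>2" using R by (intro power_mono) auto
    then show ?case by (simp add: path_length_def)
  next
    case (Suc K)
    define a b c where "a = norm (z (K + 1) - y (K + 1))" and "b = norm (z (K + 1) - y K)"
      and "c = norm (y (K + 1) - y K)"
    have "a \<le> R" "b \<le> R" "0 \<le> a" "0 \<le> b"
      using R Suc.hyps by (auto simp: a_def b_def)
    have "a - b \<le> c"
      unfolding a_def b_def c_def by norm
    have "a\<^sup>2 - b\<^sup>2 = (a - b) * (a + b)" by (simp add: power2_eq_square algebra_simps)
    also have "\<dots> \<le> c * (2 * R)"
      using \<open>a - b \<le> c\<close> \<open>a \<le> R\<close> \<open>b \<le> R\<close> \<open>0 \<le> a\<close> \<open>0 \<le> b\<close>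
      by (intro mult_mono) (auto simp: c_def)
    finally have "a\<^sup>2 - b\<^sup>2 \<le> 2 * R * c" by (simp add: mult_ac)
    moreover have "path_length y (Suc K) = path_length y K + c"
      using Suc.hyps by (simp add: path_length_def c_def)
    ultimately show ?case
      using Suc.IH Suc.hyps by (simp add: a_def b_def distrib_left)
  qed
  then show ?thesis by (smt (verit) zero_le_power2)
qed

section \<open>Moments of the errors\<close>

text \<open>
  Integrating the conditional second moment removes the conditioning; the first moment then follows
  from nonnegativity of the variance.
\<close>

lemma conditional_error_bound_imp_expectation_norm:
  fixes e :: "nat \<Rightarrow> 'w \<Rightarrow> 'a::euclidean_space"
  assumes prob: "prob_space M"
    and meas: "\<And>k. k \<ge> 1 \<Longrightarrow> e k \<in> borel_measurable M"
    and bound: "conditional_error_bound M e \<epsilon>"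
    and k: "k \<ge> 1" and \<epsilon>: "0 \<le> \<epsilon> k"
  shows "integrable M (\<lambda>\<omega>. norm (e k \<omega>))" "prob_space.expectation M (\<lambda>\<omega>. norm (e k \<omega>)) \<le> \<epsilon> k"
proof -
  interpret prob_space M by (rule prob)
  let ?F = "error_field M e k"
  have [measurable]: "e k \<in> borel_measurable M" by (rule meas[OF k])
  interpret F: finite_measure_subalgebra M ?F
    by standard (rule subalgebra_error_field[OF meas])
  have "(\<integral>\<^sup>+\<omega>. ennreal ((norm (e k \<omega>))\<^sup>2) \<partial>M)
      = (\<integral>\<^sup>+\<omega>. nn_cond_exp M ?F (\<lambda>\<omega>. ennreal ((norm (e k \<omega>))\<^sup>2)) \<omega> \<partial>M)"
    using F.nn_cond_exp_intg[of "\<lambda>_. 1" "\<lambda>\<omega>. ennreal ((norm (e k \<omega>))\<^sup>2)"] by simp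
  also have "\<dots> \<le> (\<integral>\<^sup>+\<omega>. ennreal ((\<epsilon> k)\<^sup>2) \<partial>M)"
    using bound k by (intro nn_integral_mono_AE) (simp add: conditional_error_bound_def)
  finally have second: "(\<integral>\<^sup>+\<omega>. ennreal ((norm (e k \<omega>))\<^sup>2) \<partial>M) \<le> ennreal ((\<epsilon> k)\<^sup>2)"
    by (simp add: emeasure_space_1)
  then have int2: "integrable M (\<lambda>\<omega>. (norm (e k \<omega>))\<^sup>2)"
    by (intro integrableI_bounded) (auto intro: le_less_trans)
  show int: "integrable M (\<lambda>\<omega>. norm (e k \<omega>))"
    by (rule square_integrable_imp_integrable[OF _ int2]) simp
  have "ennreal (expectation (\<lambda>\<omega>. (norm (e k \<omega>))\<^sup>2)) \<le> ennreal ((\<epsilon> k)\<^sup>2)"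
    using second nn_integral_eq_integral[OF int2] by simp
  then have "expectation (\<lambda>\<omega>. (norm (e k \<omega>))\<^sup>2) \<le> (\<epsilon> k)\<^sup>2"
    by simp
  moreover have "(expectation (\<lambda>\<omega>. norm (e k \<omega>)))\<^sup>2 \<le> expectation (\<lambda>\<omega>. (norm (e k \<omega>))\<^sup>2)"
    using variance_positive[of "\<lambda>\<omega>. norm (e k \<omega>)"] variance_eq[OF int int2] by simp
  ultimately have "(expectation (\<lambda>\<omega>. norm (e k \<omega>)))\<^sup>2 \<le> (\<epsilon> k)\<^sup>2" by linarith
  then show "expectation (\<lambda>\<omega>. norm (e k \<omega>)) \<le> \<epsilon> k"
    using \<epsilon> by (rule power2_le_imp_le)
qed

text \<open>The geometric mean of the two bounds \<open>E \<le> E\<close> and \<open>E \<le> K \<epsilon>\<^sub>m\<^sub>a\<^sub>x\<close>.\<close>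

lemma cumulative_error_le_sqrt:
  assumes "\<And>k. k \<ge> 1 \<Longrightarrow> 0 \<le> \<epsilon> k \<and> \<epsilon> k \<le> \<epsilon>max"
  shows "cumulative_error \<epsilon> K \<le> sqrt \<epsilon>max * sqrt (real K * cumulative_error \<epsilon> K)"
proof -
  define E where "E = cumulative_error \<epsilon> K"
  have "0 \<le> E" unfolding E_def cumulative_error_def using assms by (intro sum_nonneg) auto
  have "E \<le> (\<Sum>k=1..K. \<epsilon>max)"
    unfolding E_def cumulative_error_def using assms by (intro sum_mono) auto
  then have "E * E \<le> (\<epsilon>max * real K) * E"
    using \<open>0 \<le> E\<close> by (intro mult_right_mono) (simp_all add: mult.commute)
  then have "sqrt (E * E) \<le> sqrt (\<epsilon>max * (real K * E))"
    by (simp only: mult.assoc real_sqrt_le_iff)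
  then show ?thesis
    using \<open>0 \<le> E\<close> by (simp add: E_def real_sqrt_mult)
qed

section \<open>Expected dynamic regret\<close>

text \<open>
  The gradient maps are only assumed continuous on \<open>X\<close>, so their composition with an iterate is
  measurable only because the iterate takes values in \<open>X\<close>; membership and measurability are
  therefore proved together, as measurability into the restricted Borel space.
\<close>

lemma iterates_in_and_measurable:
  fixes X :: "'a::euclidean_space set" and x :: "nat \<Rightarrow> 'w \<Rightarrow> 'a"
  assumes X: "convex X" "closed X" and x1: "x1 \<in> X"
    and cont: "\<And>k. k \<ge> 1 \<Longrightarrow> continuous_on X (g k)"
    and meas: "\<And>k. k \<ge> 1 \<Longrightarrow> e k \<in> borel_measurable M"
    and init: "\<And>\<omega>. \<omega> \<in> space M \<Longrightarrow> x 1 \<omega> = x1"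
    and step: "\<And>k \<omega>. k \<ge> 1 \<Longrightarrow> \<omega> \<in> space M \<Longrightarrow>
      x (k + 1) \<omega> = closest_point X (x k \<omega> - \<alpha> *\<^sub>R (g k (x k \<omega>) + e k \<omega>))"
    and "k \<ge> 1"
  shows "x k \<in> measurable M (restrict_space borel X)"
  using \<open>k \<ge> 1\<close>
proof (induction k rule: nat_induct_at_least)
  case base
  have "(\<lambda>_. x1) \<in> measurable M (restrict_space borel X)"
    using x1 by (simp add: space_restrict_space)
  then show ?case
    using init by (subst measurable_cong[of _ _ "\<lambda>_. x1"]) auto
next
  case (Suc k)
  have X_ne: "X \<noteq> {}" using x1 by blast
  have [measurable]: "closest_point X \<in> borel_measurable borel"
    using X X_ne by (intro borel_measurable_continuous_onI continuous_on_closest_point)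
  have [measurable]: "x k \<in> borel_measurable M"
    using Suc.IH by (rule measurable_restrict_space2_iff[THEN iffD1, THEN conjunct1])
  have [measurable]: "e k \<in> borel_measurable M" using meas Suc.hyps by simp
  have [measurable]: "(\<lambda>\<omega>. g k (x k \<omega>)) \<in> borel_measurable M"
    using Suc.IH borel_measurable_continuous_on_restrict[OF cont[OF Suc.hyps]] by (rule measurable_compose)
  have "(\<lambda>\<omega>. closest_point X (x k \<omega> - \<alpha> *\<^sub>R (g k (x k \<omega>) + e k \<omega>))) \<in> measurable M (restrict_space borel X)"
    using X X_ne by (intro measurable_restrict_space2) (auto intro: closest_point_in_set)
  then show ?case
    using step[OF Suc.hyps] by (subst measurable_cong) auto
qed

theorem theorem2:
  fixes M :: "'w measure"
    and X :: "(real ^ 'n) set"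
    and f :: "nat \<Rightarrow> real ^ 'n \<Rightarrow> real"
    and xstar :: "nat \<Rightarrow> real ^ 'n"
    and x1 :: "real ^ 'n"
    and x :: "nat \<Rightarrow> 'w \<Rightarrow> real ^ 'n"
    and e :: "nat \<Rightarrow> 'w \<Rightarrow> real ^ 'n"
    and \<epsilon> :: "nat \<Rightarrow> real"
    and \<epsilon>max R L \<alpha> :: real
  assumes prob: "prob_space M"
    and P2: "class_P2 X R f"
    and xstar: "\<And>k. k \<ge> 1 \<Longrightarrow> xstar k \<in> minimizers (f k) X"
    and sublinear: "(\<lambda>K. path_length xstar K / real K) \<longlonglongrightarrow> 0"
    and e_meas: "\<And>k. k \<ge> 1 \<Longrightarrow> e k \<in> borel_measurable M"
    and x1_in: "x1 \<in> X"
    and x_init: "\<And>\<omega>. \<omega> \<in> space M \<Longrightarrow> x 1 \<omega> = x1"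
    and x_step: "\<And>k \<omega>. k \<ge> 1 \<Longrightarrow> \<omega> \<in> space M \<Longrightarrow>
      x (k + 1) \<omega> = closest_point X (x k \<omega> - \<alpha> *\<^sub>R (gradient (f k) (x k \<omega>) + e k \<omega>))"
    and L_pos: "0 < L"
    and alpha: "0 < \<alpha>" "\<alpha> < 1 / (2 * L)"
    and A1: "conditional_error_bound M e \<epsilon>"
    and eps: "\<And>k. k \<ge> 1 \<Longrightarrow> 0 \<le> \<epsilon> k \<and> \<epsilon> k \<le> \<epsilon>max"
    and A3: "\<And>k u v. k \<ge> 1 \<Longrightarrow> u \<in> X \<Longrightarrow> v \<in> X \<Longrightarrow>
      norm (gradient (f k) u - gradient (f k) v) \<le> L * norm (u - v)"
    and A4: "\<And>k z. k \<ge> 1 \<Longrightarrow> z \<in> minimizers (f k) X \<Longrightarrow>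
      z \<in> rel_interior X \<and> gradient (f k) z = 0"
  shows "\<exists>C. \<forall>K\<ge>1.
    integrable M (\<lambda>\<omega>. regret f (\<lambda>k. x k \<omega>) xstar K) \<and>
    prob_space.expectation M (\<lambda>\<omega>. regret f (\<lambda>k. x k \<omega>) xstar K)
      \<le> C * (1 + sqrt (real K * cumulative_error \<epsilon> K) + path_length xstar K)"
proof -
  interpret prob_space M by (rule prob)
  define g where "g k = gradient (f k)" for k
  have X: "X \<noteq> {}" "compact X" "convex X" "diameter X = R"
    and convex: "\<And>k. k \<ge> 1 \<Longrightarrow> convex_on UNIV (f k)"
    and diff: "\<And>k z. k \<ge> 1 \<Longrightarrow> f k differentiable (at z)"
    using P2 by (auto simp: class_P2_def)
  have closed: "closed X" using X by (simp add: compact_imp_closed)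
  have R: "norm (u - v) \<le> R" if "u \<in> X" "v \<in> X" for u v
    using diameter_bounded_bound[OF compact_imp_bounded that] X by (simp add: dist_norm)
  have R0: "0 \<le> R" using diameter_ge_0[OF compact_imp_bounded] X by auto
  have gderiv: "GDERIV (f k) z :> g k z" if "k \<ge> 1" for k z
    unfolding g_def by (rule gderiv_gradient[OF diff[OF that]])
  have lip: "norm (g k u - g k v) \<le> L * norm (u - v)" if "k \<ge> 1" "u \<in> X" "v \<in> X" for k u v
    unfolding g_def by (rule A3[OF that])
  have xstar_in: "xstar k \<in> rel_interior X" "g k (xstar k) = 0" "xstar k \<in> X" if "k \<ge> 1" for k
    using A4[OF that xstar[OF that]] rel_interior_subset by (auto simp: g_def)
  have x_meas: "x k \<in> measurable M (restrict_space borel X)" if "k \<ge> 1" for k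
    using x_init x_step that
    by (intro iterates_in_and_measurable[OF X(3) closed x1_in _ e_meas, where g = g])
      (auto simp: g_def intro: lipschitz_gradient_continuous[OF A3])
  have x_in: "x k \<omega> \<in> X" if "k \<ge> 1" "\<omega> \<in> space M" for k \<omega>
    using measurable_space[OF x_meas that(2)] that by (simp add: space_restrict_space)
  have \<alpha>L: "\<alpha> * L \<le> 1"
    using alpha L_pos by (simp add: field_simps)
  have cost_integrable: "integrable M (\<lambda>\<omega>. f k (x k \<omega>))" if k: "k \<ge> 1" for k
  proof -
    have cont: "continuous_on X (f k)"
      using diff[OF k] by (intro continuous_at_imp_continuous_on ballI differentiable_imp_continuous_within)
    then have "(\<lambda>\<omega>. f k (x k \<omega>)) \<in> borel_measurable M"
      by (intro measurable_compose[OF x_meas[OF k]] borel_measurable_continuous_on_restrict)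
    moreover obtain B where "\<And>u. u \<in> X \<Longrightarrow> norm (f k u) \<le> B"
      using compact_imp_bounded[OF compact_continuous_image[OF cont X(2)]] by (auto simp: bounded_iff)
    ultimately show ?thesis
      using x_in[OF k] by (intro integrable_const_bound[of _ B]) auto
  qed
  have e_int: "integrable M (\<lambda>\<omega>. norm (e k \<omega>))" and e_exp: "expectation (\<lambda>\<omega>. norm (e k \<omega>)) \<le> \<epsilon> k"
    if "k \<ge> 1" for k
    using conditional_error_bound_imp_expectation_norm[OF prob e_meas A1 that] eps[OF that] by auto
  define C where "C = R\<^sup>2 / \<alpha> + 2 * R / \<alpha> + 2 * R * sqrt \<epsilon>max"
  have "integrable M (\<lambda>\<omega>. regret f (\<lambda>k. x k \<omega>) xstar K) \<and>
    expectation (\<lambda>\<omega>. regret f (\<lambda>k. x k \<omega>) xstar K)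
      \<le> C * (1 + sqrt (real K * cumulative_error \<epsilon> K) + path_length xstar K)" if K: "K \<ge> 1" for K
  proof
    define W S where "W = path_length xstar K" and "S = sqrt (real K * cumulative_error \<epsilon> K)"
    have W0: "0 \<le> W" unfolding W_def path_length_def by (intro sum_nonneg) auto
    have S0: "0 \<le> S" and max0: "0 \<le> sqrt \<epsilon>max"
      using eps order_trans[of 0 "\<epsilon> 1" \<epsilon>max] by (auto simp: S_def cumulative_error_def intro!: mult_nonneg_nonneg sum_nonneg)
    show int: "integrable M (\<lambda>\<omega>. regret f (\<lambda>k. x k \<omega>) xstar K)"
      unfolding regret_def by (intro Bochner_Integration.integrable_sum Bochner_Integration.integrable_diff cost_integrable) auto
    have pathwise: "regret f (\<lambda>k. x k \<omega>) xstar K \<le> (R\<^sup>2 + 2 * R * W) / \<alpha> + 2 * R * (\<Sum>k=1..K. norm (e k \<omega>))"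
      if \<omega>: "\<omega> \<in> space M" for \<omega>
    proof -
      have "regret f (\<lambda>k. x k \<omega>) xstar K \<le> (\<Sum>k=1..K.
          ((norm (x k \<omega> - xstar k))\<^sup>2 - (norm (x (k + 1) \<omega> - xstar k))\<^sup>2) / \<alpha> + 2 * R * norm (e k \<omega>))"
        unfolding regret_def
      proof (rule sum_mono)
        fix k assume "k \<in> {1..K}"
        then have k: "k \<ge> 1" by simp
        show "f k (x k \<omega>) - f k (xstar k)
            \<le> ((norm (x k \<omega> - xstar k))\<^sup>2 - (norm (x (k + 1) \<omega> - xstar k))\<^sup>2) / \<alpha> + 2 * R * norm (e k \<omega>)"
          using inexact_gradient_step_regret[OF convex[OF k] gderiv[OF k] lip[OF k] X(3,2) x_in[OF k \<omega>]
              xstar_in(1,2)[OF k] alpha(1) \<alpha>L, of "e k \<omega>"]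
          unfolding x_step[OF k \<omega>] X(4) g_def by simp
      qed
      also have "\<dots> = (\<Sum>k=1..K. (norm (x k \<omega> - xstar k))\<^sup>2 - (norm (x (k + 1) \<omega> - xstar k))\<^sup>2) / \<alpha>
          + 2 * R * (\<Sum>k=1..K. norm (e k \<omega>))"
        by (simp add: sum.distrib sum_divide_distrib sum_distrib_left)
      also have "\<dots> \<le> (R\<^sup>2 + 2 * R * W) / \<alpha> + 2 * R * (\<Sum>k=1..K. norm (e k \<omega>))"
        unfolding W_def using alpha(1) K R x_in[OF _ \<omega>] xstar_in(3)
        by (intro add_right_mono divide_right_mono drifting_distance_telescope) auto
      finally show ?thesis .
    qed
    have int_sum: "integrable M (\<lambda>\<omega>. \<Sum>k=1..K. norm (e k \<omega>))"
      by (intro Bochner_Integration.integrable_sum e_int) auto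
    have "expectation (\<lambda>\<omega>. regret f (\<lambda>k. x k \<omega>) xstar K)
        \<le> expectation (\<lambda>\<omega>. (R\<^sup>2 + 2 * R * W) / \<alpha> + 2 * R * (\<Sum>k=1..K. norm (e k \<omega>)))"
      using int_sum pathwise int by (intro integral_mono) auto
    also have "\<dots> = (R\<^sup>2 + 2 * R * W) / \<alpha> + 2 * R * (\<Sum>k=1..K. expectation (\<lambda>\<omega>. norm (e k \<omega>)))"
      using int_sum e_int by (simp add: prob_space Bochner_Integration.integral_sum)
    also have "\<dots> \<le> (R\<^sup>2 + 2 * R * W) / \<alpha> + 2 * R * cumulative_error \<epsilon> K"
      unfolding cumulative_error_def using R0 e_exp by (intro add_left_mono mult_left_mono sum_mono) auto
    also have "\<dots> \<le> (R\<^sup>2 + 2 * R * W) / \<alpha> + 2 * R * (sqrt \<epsilon>max * S)"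
      unfolding S_def using R0 cumulative_error_le_sqrt[OF eps]
      by (intro add_left_mono mult_left_mono) auto
    also have "\<dots> = R\<^sup>2 / \<alpha> * 1 + 2 * R * sqrt \<epsilon>max * S + 2 * R / \<alpha> * W"
      by (simp add: add_divide_distrib)
    also have "\<dots> \<le> C * 1 + C * S + C * W"
      unfolding C_def using R0 alpha(1) W0 S0 max0 by (intro add_mono mult_right_mono) auto
    also have "\<dots> = C * (1 + S + W)" by (simp add: distrib_left)
    finally show "expectation (\<lambda>\<omega>. regret f (\<lambda>k. x k \<omega>) xstar K)
      \<le> C * (1 + sqrt (real K * cumulative_error \<epsilon> K) + path_length xstar K)"
      unfolding S_def W_def .
  qed
  then show ?thesis by blast
qed

end
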